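(* Let $n\ge 1$ and let $A,B,X$ be complex $n\times n$ matrices such that the $2n\times 2n$ block matrix $\begin{bmatrix} A & X\\ X^* & B\end{bmatrix}$ is positive. Let $d$ be the distance from $0$ to $W(X)$. Then $$ \mathrm{diam}\, W\left(\begin{bmatrix} A & X\\ X^* & B\end{bmatrix}\right)-\mathrm{diam}\, W\left(\frac{A+B}{2}\right)\ \ge\ 2d . $$
   Context: "Positive" means Hermitian positive semidefinite. The numerical range of an $m\times m$ complex matrix $T$ is $W(T)=\{\langle h,Th\rangle : h\in\mathbb{C}^m,\ \|h\|=1\}$, with $\langle\cdot,\cdot\rangle$ the canonical inner product of $\mathbb{C}^m$; it is a compact convex subset of $\mathbb{C}$. $\mathrm{diam}$ denotes the diameter of a subset of $\mathbb{C}$, and the distance from $0$ to $W(X)$ is $\min\{|z| : z\in W(X)\}$. *)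

theory Defs
  imports
    "HOL-Analysis.Elementary_Metric_Spaces"
    "Jordan_Normal_Form.Schur_Decomposition"
begin

text \<open>The canonical inner product of \<open>\<complex>\<^sup>m\<close>, conjugate-linear in the \<^emph>\<open>first\<close> argument.
  The operation \<open>u \<bullet>c v\<close> conjugates its second argument, hence the swap.\<close>

definition cvec_inner :: "complex vec \<Rightarrow> complex vec \<Rightarrow> complex" where
  "cvec_inner u v = v \<bullet>c u"

definition cvec_norm :: "complex vec \<Rightarrow> real" where
  "cvec_norm v = sqrt (Re (cvec_inner v v))"

definition hermitian_mat :: "complex mat \<Rightarrow> bool" where
  "hermitian_mat T \<longleftrightarrow> mat_adjoint T = T"

text \<open>Squareness of \<open>T\<close> is implied by \<open>hermitian_mat T\<close>, which also makes every
  \<open>cvec_inner v (T *\<^sub>v v)\<close> real.\<close>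

definition positive_mat :: "complex mat \<Rightarrow> bool" where
  "positive_mat T \<longleftrightarrow>
     hermitian_mat T \<and> (\<forall>v \<in> carrier_vec (dim_row T). 0 \<le> Re (cvec_inner v (T *\<^sub>v v)))"

definition numerical_range :: "complex mat \<Rightarrow> complex set" where
  "numerical_range T =
     {cvec_inner h (T *\<^sub>v h) | h. h \<in> carrier_vec (dim_row T) \<and> cvec_norm h = 1}"

end

theory Submission
  imports Defs
begin

text \<open>
  Write \<open>M\<close> for the block matrix and, for a unit vector \<open>h\<close>, put
  \<open>s = \<langle>h, (A+B)/2 h\<rangle>\<close> and \<open>x = \<langle>h, X h\<rangle>\<close>.  For every complex \<open>z\<close> of modulus one,
  \<open>(h, z h) / \<surd>2\<close> is a unit vector at which \<open>M\<close> takes the value \<open>s + Re (z x)\<close>.  Turning the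
  phase \<open>z\<close> so that \<open>z x\<close> becomes \<open>\<bar>x\<bar>\<close> or \<open>- \<bar>x\<bar>\<close> shows that both \<open>s + \<bar>x\<bar>\<close> and
  \<open>s - \<bar>x\<bar>\<close> lie in \<open>W(M)\<close> (\<open>block_numerical_range_plus_minus\<close>),
  and \<open>\<bar>x\<bar> \<ge> d\<close> because \<open>x\<close> lies in \<open>W(X)\<close>.

  All these values are real, since \<open>M\<close> is Hermitian.  Given two points \<open>s \<ge> t\<close> of
  \<open>W((A+B)/2)\<close>, the set \<open>W(M)\<close> therefore has a point at or to the right of \<open>s + d\<close> and one at
  or to the left of \<open>t - d\<close>, so its diameter is at least \<open>s - t + 2 d\<close>.
\<close>

section \<open>The canonical inner product\<close>

lemma cvec_inner_sum:
  assumes "dim_vec u = n"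
  shows "cvec_inner u v = (\<Sum>i<n. v $ i * cnj (u $ i))"
  using assms by (simp add: cvec_inner_def scalar_prod_def atLeast0LessThan)

lemma cvec_inner_self:
  "cvec_inner u u = of_real (\<Sum>i<dim_vec u. (cmod (u $ i))\<^sup>2)"
  by (simp add: cvec_inner_sum[OF refl] complex_norm_square del: of_real_power)

lemma cvec_norm_eq_1_iff: "cvec_norm u = 1 \<longleftrightarrow> cvec_inner u u = 1"
proof -
  have "cvec_norm u = 1 \<longleftrightarrow> Re (cvec_inner u u) = 1"
    by (simp add: cvec_norm_def)
  also have "\<dots> \<longleftrightarrow> cvec_inner u u = 1"
    unfolding cvec_inner_self by (simp only: Re_complex_of_real of_real_eq_1_iff)
  finally show ?thesis .
qed

lemma cvec_inner_smult_left:
  "dim_vec v = dim_vec u \<Longrightarrow> cvec_inner (a \<cdot>\<^sub>v u) v = cnj a * cvec_inner u v"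
  by (simp add: cvec_inner_sum[OF refl] sum_distrib_left mult_ac)

lemma cvec_inner_smult_right:
  "dim_vec v = dim_vec u \<Longrightarrow> cvec_inner u (a \<cdot>\<^sub>v v) = a * cvec_inner u v"
  by (simp add: cvec_inner_sum[OF refl] sum_distrib_left mult_ac)

lemma cvec_inner_add_right:
  "dim_vec v = dim_vec u \<Longrightarrow> dim_vec w = dim_vec u \<Longrightarrow>
    cvec_inner u (v + w) = cvec_inner u v + cvec_inner u w"
  by (simp add: cvec_inner_sum[OF refl] sum.distrib algebra_simps)

lemma cvec_inner_append:
  assumes "u1 \<in> carrier_vec n" "v1 \<in> carrier_vec n" "u2 \<in> carrier_vec m" "v2 \<in> carrier_vec m"
  shows "cvec_inner (u1 @\<^sub>v u2) (v1 @\<^sub>v v2) = cvec_inner u1 v1 + cvec_inner u2 v2"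
proof -
  have "conjugate (u1 @\<^sub>v u2) = conjugate u1 @\<^sub>v conjugate u2"
    by (rule eq_vecI) auto
  then show ?thesis
    using assms by (simp add: cvec_inner_def scalar_prod_append[of _ n _ m])
qed

lemma cvec_inner_mult_mat_vec:
  assumes "T \<in> carrier_mat n m" "u \<in> carrier_vec n" "v \<in> carrier_vec m"
  shows "cvec_inner u (T *\<^sub>v v) = (\<Sum>i<n. \<Sum>j<m. T $$ (i,j) * v $ j * cnj (u $ i))"
  using assms
  by (auto simp: cvec_inner_sum[of _ n] scalar_prod_def atLeast0LessThan sum_distrib_right
      intro!: sum.cong)

lemma cvec_inner_mat_adjoint:
  assumes T: "T \<in> carrier_mat n m" and u: "u \<in> carrier_vec m" and v: "v \<in> carrier_vec n"
  shows "cvec_inner u (mat_adjoint T *\<^sub>v v) = cnj (cvec_inner v (T *\<^sub>v u))"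
proof -
  have T': "mat_adjoint T \<in> carrier_mat m n"
    using T by (auto simp: mat_adjoint_def)
  have entry: "mat_adjoint T $$ (i,j) = cnj (T $$ (j,i))" if "i < m" "j < n" for i j
    using T that by (auto simp: mat_adjoint_def mat_of_rows_def)
  have "cvec_inner u (mat_adjoint T *\<^sub>v v)
      = (\<Sum>i<m. \<Sum>j<n. cnj (T $$ (j,i)) * v $ j * cnj (u $ i))"
    by (simp add: cvec_inner_mult_mat_vec[OF T' u v] entry)
  also have "\<dots> = (\<Sum>j<n. \<Sum>i<m. cnj (T $$ (j,i)) * v $ j * cnj (u $ i))"
    by (rule sum.swap)
  also have "\<dots> = cnj (cvec_inner v (T *\<^sub>v u))"
    by (simp add: cvec_inner_mult_mat_vec[OF T v u] mult_ac)
  finally show ?thesis .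
qed

section \<open>Numerical ranges\<close>

lemma numerical_rangeI:
  "T \<in> carrier_mat n n \<Longrightarrow> h \<in> carrier_vec n \<Longrightarrow> cvec_norm h = 1 \<Longrightarrow>
    cvec_inner h (T *\<^sub>v h) \<in> numerical_range T"
  by (auto simp: numerical_range_def)

lemma numerical_rangeE:
  assumes "w \<in> numerical_range T" "T \<in> carrier_mat n n"
  obtains h where "h \<in> carrier_vec n" "cvec_norm h = 1" "w = cvec_inner h (T *\<^sub>v h)"
  using assms by (auto simp: numerical_range_def)

lemma numerical_range_nonempty:
  assumes T: "T \<in> carrier_mat n n" and "n \<ge> 1"
  shows "numerical_range T \<noteq> {}"
proof -
  have "cvec_inner (unit_vec n 0) (unit_vec n 0) = 1"
    using \<open>n \<ge> 1\<close> by (simp add: cvec_inner_def)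
  then show ?thesis
    using numerical_rangeI[OF T, of "unit_vec n 0"] by (auto simp: cvec_norm_eq_1_iff)
qed

lemma hermitian_numerical_range_real:
  assumes T: "T \<in> carrier_mat n n" and "hermitian_mat T" and "w \<in> numerical_range T"
  shows "Im w = 0"
proof -
  obtain h where h: "h \<in> carrier_vec n" and w: "w = cvec_inner h (T *\<^sub>v h)"
    using assms by (auto elim: numerical_rangeE)
  have "w = cnj w"
    using cvec_inner_mat_adjoint[OF T h h] \<open>hermitian_mat T\<close> by (simp add: w hermitian_mat_def)
  then show ?thesis
    by (simp add: complex_eq_iff)
qed

text \<open>The diameter of an unbounded set is an unspecified supremum, so lower bounds for it need
  boundedness.  Coordinates of a unit vector have modulus at most one, so the sum of the moduli
  of all entries bounds the numerical range.\<close>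

lemma bounded_numerical_range:
  assumes T: "T \<in> carrier_mat n n"
  shows "bounded (numerical_range T)"
proof (rule boundedI)
  fix w
  assume "w \<in> numerical_range T"
  then obtain h where h: "h \<in> carrier_vec n" and norm: "cvec_norm h = 1"
    and w: "w = cvec_inner h (T *\<^sub>v h)"
    using T by (auto elim: numerical_rangeE)
  have sum1: "(\<Sum>i<n. (cmod (h $ i))\<^sup>2) = 1"
    using norm h unfolding cvec_norm_eq_1_iff cvec_inner_self
    by (simp only: of_real_eq_1_iff carrier_vecD)
  have coord: "cmod (h $ i) \<le> 1" if "i < n" for i
  proof -
    have "(cmod (h $ i))\<^sup>2 \<le> (\<Sum>i<n. (cmod (h $ i))\<^sup>2)"
      using that by (intro member_le_sum) auto
    then show ?thesis
      by (simp add: sum1 abs_square_le_1)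
  qed
  have "cmod w \<le> (\<Sum>i<n. \<Sum>j<n. cmod (T $$ (i,j) * h $ j * cnj (h $ i)))"
    unfolding w cvec_inner_mult_mat_vec[OF T h h]
    by (intro order_trans[OF norm_sum] sum_mono norm_sum)
  also have "\<dots> \<le> (\<Sum>i<n. \<Sum>j<n. cmod (T $$ (i,j)))"
  proof (intro sum_mono)
    fix i j
    assume "i \<in> {..<n}" "j \<in> {..<n}"
    then have "cmod (h $ j) * cmod (h $ i) \<le> 1"
      by (intro mult_le_one) (auto simp: coord)
    then show "cmod (T $$ (i,j) * h $ j * cnj (h $ i)) \<le> cmod (T $$ (i,j))"
      by (simp add: norm_mult mult.assoc mult_left_le)
  qed
  finally show "cmod w \<le> (\<Sum>i<n. \<Sum>j<n. cmod (T $$ (i,j)))" .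
qed

section \<open>Test vectors for a block matrix\<close>

lemma cvec_inner_four_block_mat:
  assumes A: "A \<in> carrier_mat n n" and B: "B \<in> carrier_mat n n" and X: "X \<in> carrier_mat n n"
    and h: "h \<in> carrier_vec n" and k: "k \<in> carrier_vec n"
  shows "cvec_inner (h @\<^sub>v k) (four_block_mat A X (mat_adjoint X) B *\<^sub>v (h @\<^sub>v k))
    = cvec_inner h (A *\<^sub>v h) + cvec_inner k (B *\<^sub>v k)
      + cvec_inner h (X *\<^sub>v k) + cnj (cvec_inner h (X *\<^sub>v k))"
proof -
  have X': "mat_adjoint X \<in> carrier_mat n n"
    using X by (auto simp: mat_adjoint_def)
  have "cvec_inner (h @\<^sub>v k) (four_block_mat A X (mat_adjoint X) B *\<^sub>v (h @\<^sub>v k))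
    = cvec_inner (h @\<^sub>v k) ((A *\<^sub>v h + X *\<^sub>v k) @\<^sub>v (mat_adjoint X *\<^sub>v h + B *\<^sub>v k))"
    by (simp add: four_block_mat_mult_vec[OF A X X' B h k])
  also have "\<dots> = cvec_inner h (A *\<^sub>v h + X *\<^sub>v k) + cvec_inner k (mat_adjoint X *\<^sub>v h + B *\<^sub>v k)"
    by (rule cvec_inner_append[of _ n _ _ n]) (use A B X X' h k in auto)
  also have "\<dots> = cvec_inner h (A *\<^sub>v h) + cvec_inner h (X *\<^sub>v k)
      + (cvec_inner k (mat_adjoint X *\<^sub>v h) + cvec_inner k (B *\<^sub>v k))"
    using A B X X' h k by (simp add: cvec_inner_add_right)
  finally show ?thesis
    by (simp add: cvec_inner_mat_adjoint[OF X k h])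
qed

lemma cvec_inner_half_sum:
  assumes "A \<in> carrier_mat n n" and "B \<in> carrier_mat n n" and "h \<in> carrier_vec n"
  shows "cvec_inner h (((1/2) \<cdot>\<^sub>m (A + B)) *\<^sub>v h)
    = (cvec_inner h (A *\<^sub>v h) + cvec_inner h (B *\<^sub>v h)) / 2"
proof -
  have "((1/2) \<cdot>\<^sub>m (A + B)) *\<^sub>v h = (1/2) \<cdot>\<^sub>v (A *\<^sub>v h + B *\<^sub>v h)"
    using assms
    by (intro eq_vecI) (auto simp: add_scalar_prod_distrib[of _ n] distrib_left)
  then show ?thesis
    using assms by (simp add: cvec_inner_smult_right cvec_inner_add_right)
qed

text \<open>The point is the value of the block matrix at the unit vector \<open>(h, z h) / \<surd>2\<close>: the
  diagonal blocks contribute the mean of their values at \<open>h\<close>, and the two off-diagonal blocks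
  contribute half of \<open>z \<langle>h, X h\<rangle>\<close> and half of its conjugate.\<close>

lemma block_numerical_range_phase:
  assumes A: "A \<in> carrier_mat n n" and B: "B \<in> carrier_mat n n" and X: "X \<in> carrier_mat n n"
    and h: "h \<in> carrier_vec n" and norm: "cvec_norm h = 1" and z: "cmod z = 1"
  shows "cvec_inner h (((1/2) \<cdot>\<^sub>m (A + B)) *\<^sub>v h) + of_real (Re (z * cvec_inner h (X *\<^sub>v h)))
    \<in> numerical_range (four_block_mat A X (mat_adjoint X) B)"
    (is "?val \<in> numerical_range ?M")
proof -
  define c :: complex where "c = of_real (1 / sqrt 2)"
  have cc: "cnj c * c = 1 / 2"
    unfolding c_def complex_cnj_complex_of_real of_real_mult[symmetric] by (simp add: real_div_sqrt)
  have zz: "cnj z * z = 1"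
    using z by (simp add: complex_norm_square[symmetric] mult.commute)
  let ?u = "c \<cdot>\<^sub>v h" and ?v = "(z * c) \<cdot>\<^sub>v h"
  have M: "?M \<in> carrier_mat (n + n) (n + n)"
    using A B by simp
  have mixed: "cvec_inner (a \<cdot>\<^sub>v h) (T *\<^sub>v (b \<cdot>\<^sub>v h)) = cnj a * b * cvec_inner h (T *\<^sub>v h)"
    if "T \<in> carrier_mat n n" for a b T
    using that h
    by (simp add: mult_mat_vec[of _ n n] cvec_inner_smult_left cvec_inner_smult_right)
  have zc: "cnj (z * c) * (z * c) = 1 / 2"
  proof -
    have "cnj (z * c) * (z * c) = (cnj z * z) * (cnj c * c)"
      by (simp add: mult_ac)
    then show ?thesis
      by (simp add: cc zz)
  qed
  have cz: "cnj c * (z * c) = z / 2"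
  proof -
    have "cnj c * (z * c) = z * (cnj c * c)"
      by (simp add: mult_ac)
    then show ?thesis
      by (simp add: cc)
  qed
  have "cvec_inner (?u @\<^sub>v ?v) (?u @\<^sub>v ?v) = cnj c * c + cnj (z * c) * (z * c)"
    using h norm
    by (simp add: cvec_inner_append[of _ n _ _ n] cvec_inner_smult_left cvec_inner_smult_right
        cvec_norm_eq_1_iff mult.assoc)
  then have "cvec_norm (?u @\<^sub>v ?v) = 1"
    unfolding cc zc by (simp add: cvec_norm_eq_1_iff)
  then have "cvec_inner (?u @\<^sub>v ?v) (?M *\<^sub>v (?u @\<^sub>v ?v)) \<in> numerical_range ?M"
    using h by (intro numerical_rangeI[OF M]) auto
  also have "cvec_inner (?u @\<^sub>v ?v) (?M *\<^sub>v (?u @\<^sub>v ?v))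
    = (cvec_inner h (A *\<^sub>v h) + cvec_inner h (B *\<^sub>v h)) / 2
      + (z * cvec_inner h (X *\<^sub>v h) + cnj (z * cvec_inner h (X *\<^sub>v h))) / 2"
  proof -
    have "?u \<in> carrier_vec n" "?v \<in> carrier_vec n"
      using h by auto
    then have "cvec_inner (?u @\<^sub>v ?v) (?M *\<^sub>v (?u @\<^sub>v ?v))
      = 1 / 2 * cvec_inner h (A *\<^sub>v h) + 1 / 2 * cvec_inner h (B *\<^sub>v h)
        + z / 2 * cvec_inner h (X *\<^sub>v h) + cnj (z / 2 * cvec_inner h (X *\<^sub>v h))"
      unfolding cvec_inner_four_block_mat[OF A B X \<open>?u \<in> _\<close> \<open>?v \<in> _\<close>]
        mixed[OF A] mixed[OF B] mixed[OF X] cc zc cz by simp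
    then show ?thesis
      by (simp add: add_divide_distrib)
  qed
  also have "\<dots> = ?val"
    unfolding cvec_inner_half_sum[OF A B h] complex_add_cnj by simp
  finally show ?thesis .
qed

text \<open>For \<open>x \<noteq> 0\<close> the phase \<open>cnj x / \<bar>x\<bar>\<close> turns \<open>x\<close> into its modulus, and the opposite phase
  turns it into minus its modulus.\<close>

lemma block_numerical_range_plus_minus:
  assumes "A \<in> carrier_mat n n" and "B \<in> carrier_mat n n" and "X \<in> carrier_mat n n"
    and "h \<in> carrier_vec n" and "cvec_norm h = 1"
  defines "s \<equiv> cvec_inner h (((1/2) \<cdot>\<^sub>m (A + B)) *\<^sub>v h)"
    and "x \<equiv> cvec_inner h (X *\<^sub>v h)"
    and "W \<equiv> numerical_range (four_block_mat A X (mat_adjoint X) B)"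
  shows "s + of_real (cmod x) \<in> W" and "s - of_real (cmod x) \<in> W"
proof -
  obtain z where z: "cmod z = 1" "z * x = of_real (cmod x)"
  proof (cases "x = 0")
    case True
    then show ?thesis
      using that[of 1] by simp
  next
    case False
    then have "cnj x / of_real (cmod x) * x = of_real (cmod x)"
      by (simp add: complex_norm_square[symmetric] mult.commute[of "cnj x"] power2_eq_square)
    then show ?thesis
      using that[of "cnj x / of_real (cmod x)"] False by (simp add: norm_divide)
  qed
  note phase = block_numerical_range_phase[OF assms(1-5), folded s_def x_def W_def]
  show "s + of_real (cmod x) \<in> W"
    using phase[of z] z by simp
  show "s - of_real (cmod x) \<in> W"
    using phase[of "- z"] z by simp
qed

theorem corollary2p5:
  fixes n :: nat and A B X :: "complex mat"
  assumes "n \<ge> 1"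
    and "A \<in> carrier_mat n n" and "B \<in> carrier_mat n n" and "X \<in> carrier_mat n n"
    and "positive_mat (four_block_mat A X (mat_adjoint X) B)"
  shows "diameter (numerical_range (four_block_mat A X (mat_adjoint X) B))
       - diameter (numerical_range ((1/2) \<cdot>\<^sub>m (A + B)))
       \<ge> 2 * infdist 0 (numerical_range X)"
proof -
  note A = assms(2) and B = assms(3) and X = assms(4)
  let ?M = "four_block_mat A X (mat_adjoint X) B" and ?S = "(1/2) \<cdot>\<^sub>m (A + B)"
  define d where "d = infdist 0 (numerical_range X)"
  define D where "D = diameter (numerical_range ?M)"
  have M: "?M \<in> carrier_mat (n + n) (n + n)" and S: "?S \<in> carrier_mat n n"
    using A B by auto
  have dist_le: "dist p q \<le> D" if "p \<in> numerical_range ?M" "q \<in> numerical_range ?M" for p q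
    unfolding D_def using bounded_numerical_range[OF M] that by (rule diameter_bounded_bound)
  have real: "Im p = 0" if "p \<in> numerical_range ?M" for p
    using hermitian_numerical_range_real[OF M _ that] assms(5) by (simp add: positive_mat_def)
  have spread: "\<exists>r \<ge> d. s + of_real r \<in> numerical_range ?M \<and> s - of_real r \<in> numerical_range ?M"
    if mem: "s \<in> numerical_range ?S" for s
  proof -
    obtain h where h: "h \<in> carrier_vec n" "cvec_norm h = 1" and s: "s = cvec_inner h (?S *\<^sub>v h)"
      using numerical_rangeE[OF mem S] .
    have "d \<le> dist 0 (cvec_inner h (X *\<^sub>v h))"
      unfolding d_def using numerical_rangeI[OF X h] by (rule infdist_le)
    then show ?thesis
      using block_numerical_range_plus_minus[OF A B X h] by (auto simp: s)
  qed
  have ordered: "dist s t + 2 * d \<le> D"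
    if s: "s \<in> numerical_range ?S" and t: "t \<in> numerical_range ?S" and le: "Re t \<le> Re s" for s t
  proof -
    obtain r where r: "r \<ge> d" "s + of_real r \<in> numerical_range ?M"
      using spread[OF s] by blast
    obtain r' where r': "r' \<ge> d" "t - of_real r' \<in> numerical_range ?M"
      using spread[OF t] by blast
    have "Im s = 0" "Im t = 0"
      using real[OF r(2)] real[OF r'(2)] by auto
    then have "dist s t = Re s - Re t"
      using le by (simp add: dist_norm cmod_eq_Re)
    moreover have "(Re s + r) - (Re t - r') \<le> dist (s + of_real r) (t - of_real r')"
      using complex_Re_le_cmod[of "s + of_real r - (t - of_real r')"] by (simp add: dist_norm)
    ultimately show ?thesis
      using dist_le[OF r(2) r'(2)] r(1) r'(1) by linarith
  qed
  have "dist s t \<le> D - 2 * d" if "s \<in> numerical_range ?S" "t \<in> numerical_range ?S" for s t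
    using ordered[of s t] ordered[of t s] that by (cases "Re t \<le> Re s") (auto simp: dist_commute)
  then have "diameter (numerical_range ?S) \<le> D - 2 * d"
    using numerical_range_nonempty[OF S \<open>n \<ge> 1\<close>] by (intro diameter_le) (auto simp: dist_norm)
  then show ?thesis
    by (simp add: d_def D_def)
qed

end
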